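(* Let $d\geq 3$ and let $x_1,\ldots,x_8\in\mathbb{R}^d$ be the eight points listed in the context. The $8\times 8$ matrix $H$ with entries $$H_{ij}=\frac{1}{|\mathbb{S}^{d-1}|}\int_{\mathbb{S}^{d-1}}(x_i^Tw)_+\,(w^Tx_j)_+\,dw,\qquad 1\le i,j\le 8,$$ is singular.
   Context: $\mathbb{S}^{d-1}$ is the unit sphere in $\mathbb{R}^d$, $dw$ is its surface measure and $|\mathbb{S}^{d-1}|$ its total surface measure. For $z\in\mathbb{R}$, $(z)_+=z$ if $z>0$ and $(z)_+=0$ if $z\le 0$. With $s=1/\sqrt{3}$ and $\mathbf{0}\in\mathbb{R}^{d-3}$ the zero vector, the eight points are $x_1=(s,s,s,\mathbf{0})$, $x_2=(-s,s,s,\mathbf{0})$, $x_3=(s,-s,s,\mathbf{0})$, $x_4=(s,s,-s,\mathbf{0})$, $x_5=(-s,-s,s,\mathbf{0})$, $x_6=(-s,s,-s,\mathbf{0})$, $x_7=(s,-s,-s,\mathbf{0})$, $x_8=(-s,-s,-s,\mathbf{0})$. *)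

theory Defs
  imports "HOL-Analysis.Analysis"
begin

(* The surface measure on the unit sphere of a Euclidean space of dimension d, in its usual
   description by cones: sigma(A) = d * lebesgue {r w | 0 < r < 1, w : A}.  The radial
   projection x / |x| pushes the Lebesgue measure of the punctured unit ball forward to the
   sphere, and the preimage of A under it is that cone; the factor d makes sigma the measure
   in the polar coordinate formula  dx = r^(d-1) dr dsigma(w). *)
definition sphere_measure :: "'a::euclidean_space measure" where
  "sphere_measure =
     scale_measure (of_nat DIM('a))
       (distr (restrict_space lborel (ball 0 1 - {0}))
              (restrict_space borel (sphere 0 1))
              (\<lambda>x. x /\<^sub>R norm x))"

lemma space_sphere_measure: "space (sphere_measure :: 'a::euclidean_space measure) = sphere 0 1"
  by (simp add: sphere_measure_def space_scale_measure space_restrict_space)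

lemma sets_sphere_measure:
  "sets (sphere_measure :: 'a::euclidean_space measure) = sets (restrict_space borel (sphere 0 1))"
  by (simp add: sphere_measure_def)

lemma radial_projection_measurable:
  "(\<lambda>x::'a::euclidean_space. x /\<^sub>R norm x)
     \<in> restrict_space lborel (ball 0 1 - {0}) \<rightarrow>\<^sub>M restrict_space borel (sphere 0 1)"
proof (rule measurable_restrict_space2)
  show "(\<lambda>x::'a. x /\<^sub>R norm x) \<in> space (restrict_space lborel (ball 0 1 - {0})) \<rightarrow> sphere 0 1"
    by (auto simp: space_restrict_space)
  show "(\<lambda>x::'a. x /\<^sub>R norm x) \<in> borel_measurable (restrict_space lborel (ball 0 1 - {0}))"
    by (intro measurable_restrict_space1) simp
qed

lemma emeasure_sphere_measure:
  fixes A :: "'a::euclidean_space set"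
  assumes A: "A \<in> sets borel" "A \<subseteq> sphere 0 1"
  shows "emeasure sphere_measure A =
           of_nat DIM('a) * emeasure lborel {r *\<^sub>R w | r w. 0 < r \<and> r < 1 \<and> w \<in> A}"
proof -
  let ?B = "ball 0 1 - {0} :: 'a set"
  let ?f = "\<lambda>x::'a. x /\<^sub>R norm x"
  have As: "A \<in> sets (restrict_space borel (sphere 0 1))"
    using A by (auto simp: sets_restrict_space_iff)
  have eq: "?f -` A \<inter> ?B = {r *\<^sub>R w | r w. 0 < r \<and> r < 1 \<and> w \<in> A}" (is "?L = ?R")
  proof
    show "?L \<subseteq> ?R"
    proof
      fix x assume x: "x \<in> ?L"
      then have "x = norm x *\<^sub>R ?f x" "0 < norm x" "norm x < 1" "?f x \<in> A" by auto
      then show "x \<in> ?R" by blast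
    qed
    show "?R \<subseteq> ?L"
    proof
      fix x assume "x \<in> ?R"
      then obtain r w where x: "x = r *\<^sub>R w" "0 < r" "r < 1" "w \<in> A" by blast
      with A have "norm w = 1" by auto
      moreover from this have "w \<noteq> 0" by auto
      ultimately show "x \<in> ?L" using x by simp
    qed
  qed
  show ?thesis
    unfolding sphere_measure_def
    by (simp add: emeasure_distr[OF radial_projection_measurable As]
        emeasure_restrict_space space_restrict_space eq[symmetric] Int_commute Int_assoc)
qed

lemma measure_sphere_measure:
  "measure sphere_measure (sphere 0 1 :: 'a::euclidean_space set) =
     real DIM('a) * unit_ball_vol (real DIM('a))"
proof -
  have "sphere 0 1 \<in> sets (borel :: 'a measure)" by simp
  note e = emeasure_sphere_measure[OF this subset_refl]
  have "{r *\<^sub>R w | r w. 0 < r \<and> r < 1 \<and> w \<in> sphere 0 1} = (ball 0 1 - {0} :: 'a set)"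
    (is "?L = ?R")
  proof
    show "?L \<subseteq> ?R" by auto
    show "?R \<subseteq> ?L"
    proof
      fix x assume x: "x \<in> ?R"
      then have "x = norm x *\<^sub>R (x /\<^sub>R norm x)" "0 < norm x" "norm x < 1"
        "x /\<^sub>R norm x \<in> sphere 0 1" by auto
      then show "x \<in> ?L" by blast
    qed
  qed
  moreover have "emeasure lborel (ball 0 1 - {0} :: 'a set) = emeasure lborel (ball 0 1 :: 'a set)"
    by (subst emeasure_Diff) auto
  ultimately have "emeasure sphere_measure (sphere 0 1 :: 'a set) =
      of_nat DIM('a) * ennreal (unit_ball_vol (real DIM('a)))"
    using e by (simp add: emeasure_ball)
  then show ?thesis
    by (simp add: measure_def enn2real_mult)
qed

definition pos_part :: "real \<Rightarrow> real" where
  "pos_part z = (if z > 0 then z else 0)"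

(* The coordinates of R^d are numbered 1, ..., d by an enumeration e of the index type.
   cube_point e a b c is the vector (s a, s b, s c, 0, ..., 0) with s = 1 / sqrt 3. *)
definition cube_point :: "(nat \<Rightarrow> 'n) \<Rightarrow> real \<Rightarrow> real \<Rightarrow> real \<Rightarrow> real ^ 'n::finite" where
  "cube_point e a b c =
     (1 / sqrt 3) *\<^sub>R (\<chi> k. if k = e 1 then a else if k = e 2 then b else if k = e 3 then c else 0)"

(* Index type 8 is arithmetic modulo 8, so its elements are 1, ..., 7 and 8 = 0. *)
definition cube_points :: "(nat \<Rightarrow> 'n) \<Rightarrow> (real ^ 'n::finite) ^ 8" where
  "cube_points e = vector
     [cube_point e 1 1 1, cube_point e (-1) 1 1, cube_point e 1 (-1) 1, cube_point e 1 1 (-1),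
      cube_point e (-1) (-1) 1, cube_point e (-1) 1 (-1), cube_point e 1 (-1) (-1),
      cube_point e (-1) (-1) (-1)]"

lemma vector_nth_Cons:
  "foldr (\<lambda>x f n. fun_upd (f (n + 1)) n x) (a # l) z k i =
     (if i = k then a else foldr (\<lambda>x f n. fun_upd (f (n + 1)) n x) l z (k + 1) i)"
  by simp

lemma cube_points_nth:
  "cube_points e $ 1 = cube_point e 1 1 1"
  "cube_points e $ 2 = cube_point e (-1) 1 1"
  "cube_points e $ 3 = cube_point e 1 (-1) 1"
  "cube_points e $ 4 = cube_point e 1 1 (-1)"
  "cube_points e $ 5 = cube_point e (-1) (-1) 1"
  "cube_points e $ 6 = cube_point e (-1) 1 (-1)"
  "cube_points e $ 7 = cube_point e 1 (-1) (-1)"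
  "cube_points e $ 8 = cube_point e (-1) (-1) (-1)"
  unfolding cube_points_def vector_def vec_lambda_beta vector_nth_Cons by simp_all

end

theory Submission
  imports Defs
begin

text \<open>
  The functions \<open>w \<mapsto> pos_part (x $ j \<bullet> w)\<close> are already linearly dependent, so the singularity
  of their Gram matrix \<open>H\<close> needs no evaluation of an integral. The points form the antipodal pairs
  1-8, 2-7, 3-6, 4-5, and since \<open>pos_part z - pos_part (- z) = z\<close>, a combination of the functions
  with opposite coefficients on antipodal points is a linear functional of \<open>w\<close>. With the
  coefficient \<open>a * b * c\<close> at the cube vertex \<open>(a, b, c)\<close>, that is the sign character of the cube,
  this functional is given by the vector \<open>x1 - x2 - x3 - x4\<close>, which is zero. Thus the sign
  character is a kernel vector of \<open>H\<close>.

  What remains is that the integral commutes with this finite combination, for which the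
  products of two positive parts have to be integrable: they are continuous and bounded on the sphere,
  whose measure is finite.
\<close>

lemma pos_part_diff_minus: "pos_part z - pos_part (- z) = z"
  by (simp add: pos_part_def)

lemma continuous_on_pos_part [continuous_intros]:
  fixes f :: "'a::topological_space \<Rightarrow> real"
  assumes "continuous_on S f"
  shows "continuous_on S (\<lambda>x. pos_part (f x))"
proof -
  have "(\<lambda>x. pos_part (f x)) = (\<lambda>x. max (f x) 0)"
    by (auto simp: pos_part_def fun_eq_iff)
  then show ?thesis
    using continuous_on_max[OF assms continuous_on_const[of S 0]] by (simp only:)
qed

lemma cube_point_minus: "cube_point e (- a) (- b) (- c) = - cube_point e a b c"
  by (auto simp: cube_point_def vec_eq_iff)

text \<open>
  In each of the three coordinates that the cube occupies, the neighbours of the vertex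
  \<open>(1, 1, 1)\<close> contribute \<open>-1\<close> once and \<open>1\<close> twice.
\<close>

lemma cube_point_eq_sum_neighbours:
  "cube_point e 1 1 1 = cube_point e (- 1) 1 1 + cube_point e 1 (- 1) 1 + cube_point e 1 1 (- 1)"
  by (auto simp: cube_point_def vec_eq_iff)

lemma UNIV_8: "(UNIV :: 8 set) = {1, 2, 3, 4, 5, 6, 7, 8}"
proof -
  have "card {1, 2, 3, 4, 5, 6, 7, 8 :: 8} = card (UNIV :: 8 set)"
    by simp
  then show ?thesis
    by (metis card_subset_eq finite_class.finite_UNIV subset_UNIV)
qed

lemma sum_8:
  fixes f :: "8 \<Rightarrow> 'a::comm_monoid_add"
  shows "sum f UNIV = f 1 + f 2 + f 3 + f 4 + f 5 + f 6 + f 7 + f 8"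
  unfolding UNIV_8 by (simp add: add.assoc)

text \<open>
  Each entry is the product of the three signs of the vertex with the same index in
  \<open>cube_points\<close>.
\<close>

definition sign_character :: "real ^ 8" where
  "sign_character = vector [1, - 1, - 1, - 1, 1, 1, 1, - 1]"

lemma sign_character_nth:
  "sign_character $ 1 = 1" "sign_character $ 2 = - 1"
  "sign_character $ 3 = - 1" "sign_character $ 4 = - 1"
  "sign_character $ 5 = 1" "sign_character $ 6 = 1"
  "sign_character $ 7 = 1" "sign_character $ 8 = - 1"
  unfolding sign_character_def vector_def vec_lambda_beta vector_nth_Cons by simp_all

text \<open>
  Grouping antipodal vertices turns the sum into the inner product of \<open>w\<close> with a vector that
  vanishes by the neighbour relation.
\<close>

lemma sign_character_pos_part_dependence:
  "(\<Sum>j\<in>UNIV. pos_part (w \<bullet> cube_points e $ j) * sign_character $ j) = 0"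
proof -
  let ?x = "\<lambda>j. cube_points e $ j"
  have antipodes: "?x 8 = - ?x 1" "?x 7 = - ?x 2" "?x 6 = - ?x 3" "?x 5 = - ?x 4"
    using cube_point_minus[of e 1 1 1] cube_point_minus[of e "- 1" 1 1]
      cube_point_minus[of e 1 "- 1" 1] cube_point_minus[of e 1 1 "- 1"]
    by (simp_all add: cube_points_nth)
  have "(\<Sum>j\<in>UNIV. pos_part (w \<bullet> ?x j) * sign_character $ j) =
      (pos_part (w \<bullet> ?x 1) - pos_part (- (w \<bullet> ?x 1)))
      - (pos_part (w \<bullet> ?x 2) - pos_part (- (w \<bullet> ?x 2)))
      - (pos_part (w \<bullet> ?x 3) - pos_part (- (w \<bullet> ?x 3)))
      - (pos_part (w \<bullet> ?x 4) - pos_part (- (w \<bullet> ?x 4)))"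
    by (simp add: sum_8 sign_character_nth antipodes)
  also have "\<dots> = w \<bullet> (?x 1 - ?x 2 - ?x 3 - ?x 4)"
    by (simp add: pos_part_diff_minus inner_diff_right)
  also have "\<dots> = 0"
    by (simp add: cube_points_nth cube_point_eq_sum_neighbours)
  finally show ?thesis .
qed

lemma finite_measure_sphere_measure: "finite_measure (sphere_measure :: 'a::euclidean_space measure)"
proof
  let ?C = "{r *\<^sub>R w | r w. 0 < r \<and> r < 1 \<and> w \<in> sphere 0 1} :: 'a set"
  have "?C \<subseteq> ball 0 1"
    by auto
  then have "emeasure lborel ?C \<le> emeasure lborel (ball 0 1 :: 'a set)"
    by (intro emeasure_mono) auto
  also have "\<dots> < \<infinity>"
    by (intro emeasure_bounded_finite) simp
  finally show "emeasure sphere_measure (space (sphere_measure :: 'a measure)) \<noteq> \<infinity>"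
    by (simp add: space_sphere_measure emeasure_sphere_measure ennreal_mult_eq_top_iff)
qed

lemma integrable_sphere_measure_continuous:
  fixes f :: "'a::euclidean_space \<Rightarrow> real"
  assumes "continuous_on (sphere 0 1) f"
  shows "integrable sphere_measure f"
proof -
  interpret finite_measure "sphere_measure :: 'a measure"
    by (rule finite_measure_sphere_measure)
  have "bounded (f ` sphere 0 1)"
    using assms by (intro compact_imp_bounded compact_continuous_image) auto
  then obtain B where B: "\<And>w. w \<in> sphere 0 1 \<Longrightarrow> norm (f w) \<le> B"
    unfolding bounded_iff by blast
  show ?thesis
  proof (rule integrable_const_bound)
    show "AE w in sphere_measure. norm (f w) \<le> B"
      by (intro AE_I2 B) (simp add: space_sphere_measure)
    show "f \<in> borel_measurable sphere_measure"
      using borel_measurable_continuous_on_restrict[OF assms]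
      by (simp cong: measurable_cong_sets add: sets_sphere_measure)
  qed
qed

theorem theorem3p1:
  fixes e :: "nat \<Rightarrow> 'n::finite"
    and x :: "(real ^ 'n) ^ 8"
    and H :: "real ^ 8 ^ 8"
  assumes "CARD('n) \<ge> 3"
    and "bij_betw e {1..CARD('n)} UNIV"
    and "x = cube_points e"
    and "H = (\<chi> i j. 1 / measure sphere_measure (sphere 0 1 :: (real ^ 'n) set) *
               (LINT w|sphere_measure. pos_part (x $ i \<bullet> w) * pos_part (w \<bullet> x $ j)))"
  shows "\<not> invertible H"
proof
  assume "invertible H"
  then obtain H' where "H' ** H = mat 1"
    by (auto simp: invertible_def)
  then have trivial_kernel: "v = 0" if "H *v v = 0" for v
    using that matrix_left_invertible_ker by blast
  define m where "m = 1 / measure sphere_measure (sphere 0 1 :: (real ^ 'n) set)"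
  have "(H *v sign_character) $ i = 0" for i
  proof -
    let ?f = "\<lambda>j w. pos_part (x $ i \<bullet> w) * pos_part (w \<bullet> x $ j)"
    have int: "integrable sphere_measure (?f j)" for j
      by (intro integrable_sphere_measure_continuous continuous_intros)
    have "(H *v sign_character) $ i =
        m * (\<Sum>j\<in>UNIV. (LINT w|sphere_measure. ?f j w) * sign_character $ j)"
      by (simp add: assms(4) m_def matrix_vector_mult_def sum_distrib_left mult.assoc)
    also have "\<dots> = m * (LINT w|sphere_measure. (\<Sum>j\<in>UNIV. ?f j w * sign_character $ j))"
      using int by (simp add: Bochner_Integration.integral_sum)
    also have "(\<lambda>w. \<Sum>j\<in>UNIV. ?f j w * sign_character $ j) =
        (\<lambda>w. pos_part (x $ i \<bullet> w) * (\<Sum>j\<in>UNIV. pos_part (w \<bullet> x $ j) * sign_character $ j))"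
      by (simp add: sum_distrib_left mult.assoc)
    also have "\<dots> = (\<lambda>w. 0)"
      by (simp add: assms(3) sign_character_pos_part_dependence)
    finally show ?thesis
      by simp
  qed
  then have "H *v sign_character = 0"
    by (simp only: vec_eq_iff zero_index simp_thms)
  then have "sign_character = 0"
    by (rule trivial_kernel)
  then show False
    using sign_character_nth(1) by simp
qed

end
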